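(* Let $n\ge 1$, let $P_1,\ldots,P_n\subset\mathbb{R}^3$ be 3-dimensional polytopes relatively in general position, and let $P=P_1+\cdots+P_n$ be their Minkowski sum. Then $$2 f_2(P)-f_1(P) = \sum_{i=1}^n \bigl(2 f_2(P_i)- f_1(P_i)\bigr),$$ $$f_2(P)-f_0(P)+2 = \sum_{i=1}^n \bigl(f_2(P_i)- f_0(P_i)+2\bigr),$$ $$f_1(P)-2f_0(P)+4 = \sum_{i=1}^n \bigl(f_1(P_i)-2 f_0(P_i)+4 \bigr).$$
   Context: $f_k(Q)$ denotes the number of $k$-dimensional faces of a polytope $Q$. For $c\in\mathbb{R}^d$ let $S(Q;c)$ be the face of $Q$ on which the linear function $\langle\cdot,c\rangle$ is maximized over $Q$. Every nonempty face $F$ of a Minkowski sum $P_1+\cdots+P_n$ has a unique decomposition $F=F_1+\cdots+F_n$ where $F_i$ is a face of $P_i$ and there is a single vector $c$ with $F_i=S(P_i;c)$ for all $i$. The decomposition is exact if $\dim F=\dim F_1+\cdots+\dim F_n$. The polytopes $P_1,\dots,P_n$ are relatively in general position if every facet of $P_1+\cdots+P_n$ has an exact decomposition. *)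

theory Defs
  imports "HOL-Analysis.Analysis"
begin

(* For a polytope Q the set counted here is finite (finite_polytope_faces).
   The empty face has affine dimension -1, so it is never counted. *)
definition face_count :: "nat \<Rightarrow> 'a::euclidean_space set \<Rightarrow> nat" where
  "face_count k Q = card {F. F face_of Q \<and> aff_dim F = int k}"

definition maximizer_face :: "'a::euclidean_space set \<Rightarrow> 'a \<Rightarrow> 'a set" where
  "maximizer_face Q c = {x \<in> Q. \<forall>y\<in>Q. y \<bullet> c \<le> x \<bullet> c}"

(* Sums of sets are Minkowski sums, via the instance
   set :: (comm_monoid_add) comm_monoid_add of HOL-Library.Set_Algebras. *)
definition minkowski_decomposition ::
    "nat \<Rightarrow> (nat \<Rightarrow> 'a::euclidean_space set) \<Rightarrow> 'a set \<Rightarrow> (nat \<Rightarrow> 'a set) \<Rightarrow> bool" where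
  "minkowski_decomposition n P F G \<longleftrightarrow>
     F = (\<Sum>i = 1..n. G i) \<and>
     (\<forall>i\<in>{1..n}. G i face_of P i) \<and>
     (\<exists>c. \<forall>i\<in>{1..n}. G i = maximizer_face (P i) c)"

definition exact_decomposition ::
    "nat \<Rightarrow> (nat \<Rightarrow> 'a::euclidean_space set) \<Rightarrow> 'a set \<Rightarrow> (nat \<Rightarrow> 'a set) \<Rightarrow> bool" where
  "exact_decomposition n P F G \<longleftrightarrow>
     minkowski_decomposition n P F G \<and> aff_dim F = (\<Sum>i = 1..n. aff_dim (G i))"

(* The decomposition of a nonempty face of a sum of polytopes is unique (on the
   indices 1..n), so the existential quantifier over G refers to that decomposition. *)
definition relatively_in_general_position ::
    "nat \<Rightarrow> (nat \<Rightarrow> 'a::euclidean_space set) \<Rightarrow> bool" where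
  "relatively_in_general_position n P \<longleftrightarrow>
     (\<forall>F. F facet_of (\<Sum>i = 1..n. P i) \<longrightarrow> (\<exists>G. exact_decomposition n P F G))"

end

theory Submission
  imports Defs
begin

text \<open>Faces of different summands can be matched because \<open>maximizer_face\<close>
  commutes with Minkowski addition: one vector selects a face of the sum together with its
  decomposition. Vertices are counted on the facets because vertex numbers multiply in an exact sum,
  whereas edge numbers do not. Exactness leaves two dimension patterns for a facet, 2,0,...,0 and
  1,1,0,...,0; the second has 2 * 2 vertices, which is where the constant 4 comes from. That every
  facet of a summand reappears in the sum rests on dimensions: adding nonempty faces cannot lower
  the dimension, and a nonzero vector cannot be constant on a full-dimensional sum.

  The definition of general position yields an exact decomposition for some vector. Since the outer
  normal of a facet is unique up to a positive factor, this vector can be replaced by the unit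
  normal under which the facet is indexed.

  The Euler relation is needed in dimension 3 for the equivalence of the identities, in dimension 2
  to exchange the edges of a facet for its vertices, and in dimension 1 for the two ends of a
  segment.\<close>

text \<open>
  The three identities are equivalent by the Euler relation, so it suffices to show that
  \<open>2 f\<^sub>2 - f\<^sub>1\<close> is additive. As every edge lies in exactly two facets,
  \<open>2 (2 f\<^sub>2 - f\<^sub>1)\<close> is the sum over all facets \<open>F\<close> of \<open>4 - f\<^sub>0(F)\<close>. Indexing facets by their unit
  normals, an exact facet of the sum is either a translate of a facet of one summand, contributing
  the same amount, or a parallelogram, contributing \<open>0\<close>; and each facet of a summand arises this
  way. The Euler relation is proved by induction on the dimension, slicing with the hyperplanes
  of a generic linear functional.
\<close>

subsection \<open>The Euler relation\<close>

lemma finite_nonempty_faces: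
  fixes P :: "'a::euclidean_space set"
  assumes "polytope P"
  shows "finite {F. F face_of P \<and> F \<noteq> {}}"
  by (rule finite_subset[OF _ finite_polytope_faces[OF assms]]) auto

text \<open>The empty face is left out, so \<open>nat\<close> loses nothing; the polytope itself is
  counted, which makes the value 1 for nonempty polytopes of every dimension.\<close>

definition euler_char :: "'a::euclidean_space set \<Rightarrow> int" where
  "euler_char P = (\<Sum>F | F face_of P \<and> F \<noteq> {}. (-1) ^ nat (aff_dim F))"

text \<open>Near a relative interior point \<open>F\<close> fills its affine hull, so the slice of
  \<open>F\<close> spans the whole slice of that hull. A hyperplane that meets the hull without
  containing it lowers the dimension by one.\<close>

lemma aff_dim_Int_hyperplane_rel_interior:
  fixes F :: "'a::euclidean_space set"
  assumes x: "x \<in> rel_interior F" "h \<bullet> x = t"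
    and ne: "\<not> F \<subseteq> {y. h \<bullet> y = t}"
  shows "aff_dim (F \<inter> {y. h \<bullet> y = t}) = aff_dim F - 1"
proof -
  define H where "H = {y. h \<bullet> y = t}"
  obtain T where T: "open T" "x \<in> T" "T \<inter> affine hull F \<subseteq> F"
    using x(1) by (force simp: mem_rel_interior)
  have xF: "x \<in> F" using x(1) rel_interior_subset by blast
  have aff: "affine (affine hull F \<inter> H)"
    unfolding H_def by (intro affine_Int affine_affine_hull affine_hyperplane)
  have xin: "x \<in> (affine hull F \<inter> H) \<inter> T"
    using xF x(2) T(2) by (auto simp: H_def hull_inc)
  have eq: "affine hull ((affine hull F \<inter> H) \<inter> T) = affine hull F \<inter> H"
  proof -
    have "(affine hull F \<inter> H) \<inter> T \<noteq> {}" using xin by blast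
    then show ?thesis
      using affine_hull_affine_Int_open[OF aff T(1)] hull_same[of affine, OF aff] by simp
  qed
  have "affine hull ((affine hull F \<inter> H) \<inter> T) \<subseteq> affine hull (F \<inter> H)"
    by (rule hull_mono) (use T(3) in auto)
  then have "affine hull F \<inter> H \<subseteq> affine hull (F \<inter> H)" unfolding eq .
  moreover have "affine hull (F \<inter> H) \<subseteq> affine hull F \<inter> H"
    by (rule hull_minimal) (auto intro: hull_inc aff)
  ultimately have "aff_dim (F \<inter> H) = aff_dim (affine hull F \<inter> H)"
    by (metis aff_dim_affine_hull subset_antisym)
  also have "\<dots> = aff_dim F - 1"
    unfolding H_def
    using aff_dim_affine_Int_hyperplane[of "affine hull F" h t] xin ne
    by (metis H_def Int_iff aff_dim_affine_hull affine_affine_hull empty_iff hull_subset order_trans)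
  finally show ?thesis by (simp add: H_def)
qed

text \<open>Relative interiors of distinct faces are disjoint and slicing commutes with them, which
  gives injectivity. A face of the section comes from the smallest face of \<open>P\<close> around
  one of its relative interior points.\<close>

lemma bij_betw_faces_section:
  fixes P :: "'a::euclidean_space set"
  assumes P: "polytope P" and H: "affine H"
  shows "bij_betw (\<lambda>F. F \<inter> H) {F. F face_of P \<and> rel_interior F \<inter> H \<noteq> {}}
     {G. G face_of (P \<inter> H) \<and> G \<noteq> {}}"
proof (rule bij_betwI')
  fix F F' assume F: "F \<in> {F. F face_of P \<and> rel_interior F \<inter> H \<noteq> {}}"
    and F': "F' \<in> {F. F face_of P \<and> rel_interior F \<inter> H \<noteq> {}}"
  have ri: "rel_interior (F \<inter> H) = rel_interior F \<inter> H"
    if "F \<in> {F. F face_of P \<and> rel_interior F \<inter> H \<noteq> {}}" for F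
    using that by (intro convex_affine_rel_interior_Int H) (auto intro: face_of_imp_convex)
  show "(F \<inter> H = F' \<inter> H) = (F = F')"
  proof
    assume eq: "F \<inter> H = F' \<inter> H"
    then have "rel_interior F \<inter> H = rel_interior F' \<inter> H"
      using ri[OF F] ri[OF F'] by simp
    with F have "rel_interior F \<inter> rel_interior F' \<noteq> {}" by auto
    with F F' show "F = F'" using face_of_eq by blast
  qed auto
next
  fix F assume F: "F \<in> {F. F face_of P \<and> rel_interior F \<inter> H \<noteq> {}}"
  then have "F \<inter> H face_of P \<inter> H"
    using face_of_slice affine_imp_convex H by blast
  then show "F \<inter> H \<in> {G. G face_of (P \<inter> H) \<and> G \<noteq> {}}"
    using F rel_interior_subset by blast
next
  fix G assume G: "G \<in> {G. G face_of (P \<inter> H) \<and> G \<noteq> {}}"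
  then have "convex G" "G \<noteq> {}" using face_of_imp_convex by auto
  then obtain x where x: "x \<in> rel_interior G" using rel_interior_eq_empty by auto
  have xPH: "x \<in> P" "x \<in> H" using x G rel_interior_subset face_of_imp_subset by blast+
  define F where "F = \<Inter>{F. F face_of P \<and> x \<in> F}"
  have PF: "P face_of P" by (simp add: P face_of_refl polytope_imp_convex)
  have F: "F face_of P" unfolding F_def
    by (rule face_of_Inter) (use PF xPH in auto)
  have xF: "x \<in> F" by (auto simp: F_def)
  \<comment> \<open>Otherwise \<open>x\<close> would lie in a facet of \<open>F\<close>, a smaller
    face of \<open>P\<close> containing \<open>x\<close>, against the minimality of
    \<open>F\<close>.\<close>
  have xri: "x \<in> rel_interior F"
  proof (rule ccontr)
    assume n: "x \<notin> rel_interior F"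
    have pF: "polytope F" using P F face_of_polytope_polytope by blast
    have "x \<in> \<Union>{C. C face_of F \<and> C \<noteq> F}"
      using rel_boundary_of_polyhedron[OF polytope_imp_polyhedron[OF pF]] n xF
      unfolding facet_of_def by fastforce
    then obtain C where C: "C face_of F" "C \<noteq> F" "x \<in> C" by auto
    then have "C face_of P" using F face_of_trans by blast
    then have "F \<subseteq> C" using C by (auto simp: F_def)
    with C face_of_imp_subset show False by blast
  qed
  have "F \<inter> H face_of P \<inter> H" using F face_of_slice affine_imp_convex H by blast
  moreover have "rel_interior (F \<inter> H) = rel_interior F \<inter> H"
    by (rule convex_affine_rel_interior_Int[OF face_of_imp_convex[OF F] H]) (use xri xPH in blast)
  ultimately have "G = F \<inter> H"
    using face_of_eq[of G "P \<inter> H" "F \<inter> H"] G x xri xPH by auto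
  then show "\<exists>F\<in>{F. F face_of P \<and> rel_interior F \<inter> H \<noteq> {}}. G = F \<inter> H"
    using F xri xPH by auto
qed

text \<open>The bad vectors \<open>h\<close> are those orthogonal to some nonzero difference of
  points of \<open>V\<close>. They fill only finitely many hyperplanes, a negligible set.\<close>

lemma exists_injective_functional:
  fixes V :: "'a::euclidean_space set"
  assumes "finite V"
  obtains h where "inj_on (\<lambda>x. h \<bullet> x) V"
proof -
  let ?D = "(\<lambda>(v, w). v - w) ` (V \<times> V) - {0}"
  have "negligible (\<Union>d\<in>?D. {h. d \<bullet> h = 0})"
    using assms by (intro negligible_Union) (auto intro!: negligible_hyperplane)
  then have "(\<Union>d\<in>?D. {h. d \<bullet> h = 0}) \<noteq> UNIV" by (metis non_negligible_UNIV)
  then obtain h where h: "\<forall>d\<in>?D. d \<bullet> h \<noteq> 0" by blast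
  have "inj_on (\<lambda>x. h \<bullet> x) V"
  proof (rule inj_onI, rule ccontr)
    fix v w assume "v \<in> V" "w \<in> V" "h \<bullet> v = h \<bullet> w" "v \<noteq> w"
    then have "v - w \<in> ?D" "(v - w) \<bullet> h = 0" by (auto simp: inner_diff_right inner_commute[of _ h])
    then show False using h by blast
  qed
  then show ?thesis using that by blast
qed

section \<open>Extreme points and ranges of linear functionals\<close>

lemma polytope_eq_convex_hull_extreme_points:
  fixes P :: "'a::euclidean_space set"
  assumes "polytope P"
  shows "P = convex hull {x. x extreme_point_of P}"
  using Krein_Milman_Minkowski assms polytope_imp_compact polytope_imp_convex by blast

lemma polytope_extreme_point_exists:
  fixes P :: "'a::euclidean_space set"
  assumes "polytope P" "P \<noteq> {}"
  obtains x where "x extreme_point_of P"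
  using extreme_point_exists_convex assms polytope_imp_compact polytope_imp_convex by metis

lemma finite_extreme_points:
  fixes P :: "'a::euclidean_space set"
  assumes "polytope P"
  shows "finite {x. x extreme_point_of P}"
  using assms finite_polyhedron_extreme_points polytope_imp_polyhedron by blast

text \<open>The minimum and the maximum are attained on faces, and the extreme points of these faces
  are extreme in \<open>P\<close>.\<close>

lemma polytope_functional_range:
  fixes P :: "'a::euclidean_space set"
  assumes P: "polytope P" "P \<noteq> {}"
  obtains v w where "v extreme_point_of P" "w extreme_point_of P"
    "(\<lambda>x. h \<bullet> x) ` P = {h \<bullet> v .. h \<bullet> w}" "h \<bullet> v \<le> h \<bullet> w"
proof -
  have cont: "continuous_on P (\<lambda>x. h \<bullet> x)" by (intro continuous_intros)
  have "compact ((\<lambda>x. h \<bullet> x) ` P)"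
    by (rule compact_continuous_image[OF cont polytope_imp_compact[OF P(1)]])
  moreover have "connected ((\<lambda>x. h \<bullet> x) ` P)"
    by (rule connected_continuous_image[OF cont convex_connected[OF polytope_imp_convex[OF P(1)]]])
  ultimately obtain a b where ab: "(\<lambda>x. h \<bullet> x) ` P = {a..b}"
    using connected_compact_interval_1[of "(\<lambda>x. h \<bullet> x) ` P"] by auto
  have "(\<lambda>x. h \<bullet> x) ` P \<noteq> {}" using P(2) by blast
  then have le: "a \<le> b" unfolding ab by simp
  have bnd: "a \<le> h \<bullet> x" "h \<bullet> x \<le> b" if "x \<in> P" for x using ab that by auto
  have Fa: "P \<inter> {x. h \<bullet> x = a} face_of P"
    by (rule face_of_Int_supporting_hyperplane_ge) (use P bnd polytope_imp_convex in auto)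
  have Fb: "P \<inter> {x. h \<bullet> x = b} face_of P"
    by (rule face_of_Int_supporting_hyperplane_le) (use P bnd polytope_imp_convex in auto)
  have "a \<in> (\<lambda>x. h \<bullet> x) ` P" "b \<in> (\<lambda>x. h \<bullet> x) ` P" using ab le by auto
  then have ne: "P \<inter> {x. h \<bullet> x = a} \<noteq> {}" "P \<inter> {x. h \<bullet> x = b} \<noteq> {}" by auto
  obtain v where "v extreme_point_of P \<inter> {x. h \<bullet> x = a}"
    using polytope_extreme_point_exists face_of_polytope_polytope Fa P ne by metis
  then have v: "v extreme_point_of P" "h \<bullet> v = a"
    using extreme_point_of_face[OF Fa] by auto
  obtain w where "w extreme_point_of P \<inter> {x. h \<bullet> x = b}"
    using polytope_extreme_point_exists face_of_polytope_polytope Fb P ne by metis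
  then have w: "w extreme_point_of P" "h \<bullet> w = b"
    using extreme_point_of_face[OF Fb] by auto
  show ?thesis using that[OF v(1) w(1)] v w ab le by simp
qed

text \<open>Linear maps carry the relative interior of a convex set onto that of its image, here an
  open interval.\<close>

lemma rel_interior_meets_hyperplane_iff:
  fixes F :: "'a::euclidean_space set"
  assumes "convex F" "(\<lambda>x. h \<bullet> x) ` F = {a..b}" "a < b"
  shows "rel_interior F \<inter> {x. h \<bullet> x = t} \<noteq> {} \<longleftrightarrow> a < t \<and> t < b"
proof -
  have "(\<lambda>x. h \<bullet> x) ` rel_interior F = {a<..<b}"
    using rel_interior_convex_linear_image[of "\<lambda>x. h \<bullet> x" F] assms
    by (simp add: bounded_linear.linear bounded_linear_inner_right)
  moreover have "rel_interior F \<inter> {x. h \<bullet> x = t} \<noteq> {} \<longleftrightarrow> t \<in> (\<lambda>x. h \<bullet> x) ` rel_interior F"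
    by auto
  ultimately show ?thesis by auto
qed

text \<open>\<open>m t\<close> is the midpoint between \<open>t\<close> and its successor in
  \<open>T\<close>; only the maximum has no successor. The equivalence says that \<open>m t\<close>
  lies in the gap just above \<open>t\<close>.\<close>

lemma finite_real_set_gaps:
  fixes T :: "real set"
  assumes "finite T"
  obtains m where "\<And>t a. t \<in> T - {Max T} \<Longrightarrow> a \<in> T \<Longrightarrow> a < m t \<longleftrightarrow> a \<le> t"
    "\<And>t. t \<in> T - {Max T} \<Longrightarrow> m t \<notin> T"
proof -
  define nx where "nx t = Min {s \<in> T. t < s}" for t
  define m where "m t = (t + nx t) / 2" for t
  have nx: "nx t \<in> T" "t < nx t" "\<And>s. s \<in> T \<Longrightarrow> t < s \<Longrightarrow> nx t \<le> s" if "t \<in> T - {Max T}" for t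
  proof -
    have "Max T \<in> T" "t < Max T"
      using that assms by (metis Diff_iff Max_in empty_iff, metis Diff_iff Max_ge insertCI order_less_le)
    then have ne: "{s \<in> T. t < s} \<noteq> {}" by auto
    have fin: "finite {s \<in> T. t < s}" using assms by simp
    show "nx t \<in> T" "t < nx t" using Min_in[OF fin ne] by (auto simp: nx_def)
    show "nx t \<le> s" if "s \<in> T" "t < s" for s using Min_le[OF fin] that by (auto simp: nx_def)
  qed
  have 1: "a < m t \<longleftrightarrow> a \<le> t" if t: "t \<in> T - {Max T}" and a: "a \<in> T" for t a
    using nx(2)[OF t] nx(3)[OF t a] by (cases "t < a") (auto simp: m_def)
  have 2: "m t \<notin> T" if t: "t \<in> T - {Max T}" for t
  proof
    assume "m t \<in> T"
    then show False using 1[OF t, of "m t"] nx(2)[OF t] nx(3)[OF t, of "m t"] by (auto simp: m_def)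
  qed
  show ?thesis using that 1 2 by blast
qed

text \<open>If \<open>h\<close> were constant on \<open>F\<close>, injectivity on the vertices would
  leave \<open>F\<close> a single extreme point, hence dimension 0.\<close>

lemma face_functional_range:
  fixes P :: "'a::euclidean_space set"
  assumes P: "polytope P" and F: "F face_of P" "aff_dim F \<ge> 1"
    and inj: "inj_on (\<lambda>x. h \<bullet> x) {x. x extreme_point_of P}"
  obtains v w where "v extreme_point_of P" "w extreme_point_of P"
    "(\<lambda>x. h \<bullet> x) ` F = {h \<bullet> v .. h \<bullet> w}" "h \<bullet> v < h \<bullet> w"
proof -
  have pF: "polytope F" using P F face_of_polytope_polytope by blast
  have "F \<noteq> {}" using F by auto
  obtain v w where vw: "v extreme_point_of F" "w extreme_point_of F"
    "(\<lambda>x. h \<bullet> x) ` F = {h \<bullet> v .. h \<bullet> w}" "h \<bullet> v \<le> h \<bullet> w"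
    using polytope_functional_range[OF pF \<open>F \<noteq> {}\<close>, of h] by blast
  have ext: "x extreme_point_of P \<and> x \<in> F" if "x extreme_point_of F" for x
    using extreme_point_of_face[OF F(1)] that by blast
  have "h \<bullet> v \<noteq> h \<bullet> w"
  proof
    assume eq: "h \<bullet> v = h \<bullet> w"
    have "x = v" if "x extreme_point_of F" for x
    proof -
      have "h \<bullet> x \<in> {h \<bullet> v .. h \<bullet> w}" using ext[OF that] vw(3) by blast
      then have "h \<bullet> x = h \<bullet> v" using eq by auto
      then show ?thesis using inj ext[OF that] ext[OF vw(1)] by (auto dest: inj_onD)
    qed
    then have "{x. x extreme_point_of F} = {v}" using vw(1) by blast
    then have "F = {v}" using polytope_eq_convex_hull_extreme_points[OF pF] by simp
    then show False using F by simp
  qed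
  then have "h \<bullet> v < h \<bullet> w" using vw(4) by simp
  then show ?thesis using that ext vw(1-3) by blast
qed

text \<open>Giving weight 0 to the faces whose relative interior is missed makes the index set
  independent of \<open>t\<close>, so that sums over levels and over faces can be exchanged.\<close>

lemma euler_char_section:
  fixes P :: "'a::euclidean_space set"
  assumes P: "polytope P"
  shows "euler_char (P \<inter> {x. h \<bullet> x = t}) =
    (\<Sum>F | F face_of P \<and> F \<noteq> {}. if rel_interior F \<inter> {x. h \<bullet> x = t} = {} then 0
        else (-1) ^ nat (aff_dim (F \<inter> {x. h \<bullet> x = t})))"
proof -
  let ?H = "{x. h \<bullet> x = t}"
  have "euler_char (P \<inter> ?H) =
     (\<Sum>F | F face_of P \<and> rel_interior F \<inter> ?H \<noteq> {}. (-1) ^ nat (aff_dim (F \<inter> ?H)))"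
    unfolding euler_char_def
    by (rule sum.reindex_bij_betw[symmetric, OF bij_betw_faces_section[OF P affine_hyperplane]])
  also have "\<dots> = (\<Sum>F | F face_of P \<and> F \<noteq> {}. if rel_interior F \<inter> ?H = {} then 0
        else (-1) ^ nat (aff_dim (F \<inter> ?H)))"
    by (rule sum.mono_neutral_cong_left[OF finite_nonempty_faces[OF P]]) auto
  finally show ?thesis .
qed

text \<open>
  Summing over all levels of a generic functional \<open>h\<close> at vertices and subtracting the sum over
  the gaps between consecutive levels, each face contributes its own sign: a vertex lies on one
  level and in no gap, whereas the relative interior of any other face meets one gap more than
  levels, and its slices have the opposite sign.
\<close>

lemma face_level_gap_count:
  fixes P :: "'a::euclidean_space set"
  assumes P: "polytope P" and F: "F face_of P" "F \<noteq> {}"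
    and inj: "inj_on (\<lambda>x. h \<bullet> x) {x. x extreme_point_of P}"
    and T: "T = (\<lambda>x. h \<bullet> x) ` {x. x extreme_point_of P}"
    and m: "\<And>t a. t \<in> T - {Max T} \<Longrightarrow> a \<in> T \<Longrightarrow> a < m t \<longleftrightarrow> a \<le> t"
    "\<And>t. t \<in> T - {Max T} \<Longrightarrow> m t \<notin> T"
    and c: "\<And>t. c t = (if rel_interior F \<inter> {x. h \<bullet> x = t} = {} then 0
        else (-1) ^ nat (aff_dim (F \<inter> {x. h \<bullet> x = t})) :: int)"
  shows "(\<Sum>t\<in>T. c t) - (\<Sum>t\<in>T - {Max T}. c (m t)) = (-1) ^ nat (aff_dim F)"
proof -
  have finT: "finite T" using T finite_extreme_points[OF P] by simp
  have "aff_dim F \<ge> 0" using F(2) aff_dim_geq[of F] aff_dim_empty[of F] by linarith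
  then consider "aff_dim F = 0" | "aff_dim F \<ge> 1" by linarith
  then show ?thesis
  proof cases
    case 1
    then obtain v where v: "F = {v}" using aff_dim_eq_0 by blast
    have vT: "h \<bullet> v \<in> T" using F(1) T face_of_singleton v by blast
    have cv: "c t = (if t = h \<bullet> v then 1 else 0)" for t
    proof -
      have "F \<inter> {x. h \<bullet> x = t} = (if t = h \<bullet> v then {v} else {})" using v by auto
      then show ?thesis unfolding c using v by auto
    qed
    have "(\<Sum>t\<in>T. c t) = 1" unfolding cv using finT vT by simp
    moreover have "(\<Sum>t\<in>T - {Max T}. c (m t)) = 0"
      by (rule sum.neutral) (use cv vT m(2) in metis)
    ultimately show ?thesis using 1 by simp
  next
    case 2
    obtain v w where vw: "v extreme_point_of P" "w extreme_point_of P"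
      "(\<lambda>x. h \<bullet> x) ` F = {h \<bullet> v .. h \<bullet> w}" "h \<bullet> v < h \<bullet> w"
      using face_functional_range[OF P F(1) 2 inj] by blast
    define a b where "a = h \<bullet> v" and "b = h \<bullet> w"
    have aT: "a \<in> T" and bT: "b \<in> T" and ab: "a < b" using T vw by (auto simp: a_def b_def)
    define s :: int where "s = (-1) ^ nat (aff_dim F)"
    have cF: "c t = (if a < t \<and> t < b then - s else 0)" for t
    proof (cases "a < t \<and> t < b")
      case True
      then have ne: "rel_interior F \<inter> {x. h \<bullet> x = t} \<noteq> {}"
        using rel_interior_meets_hyperplane_iff[OF face_of_imp_convex[OF F(1)] vw(3,4)]
        by (auto simp: a_def b_def)
      then obtain x where x: "x \<in> rel_interior F" "h \<bullet> x = t" by auto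
      have "\<not> F \<subseteq> {x. h \<bullet> x = t}"
      proof
        assume "F \<subseteq> {x. h \<bullet> x = t}"
        then have "(\<lambda>x. h \<bullet> x) ` F \<subseteq> {t}" by auto
        then have "{a..b} \<subseteq> {t}" using vw(3) by (simp add: a_def b_def)
        then show False using ab by (metis atLeastAtMost_iff less_imp_le order_refl
              singletonD subsetD less_irrefl)
      qed
      then have "aff_dim (F \<inter> {x. h \<bullet> x = t}) = aff_dim F - 1"
        using aff_dim_Int_hyperplane_rel_interior x by blast
      moreover have "nat (aff_dim F) = Suc (nat (aff_dim F - 1))" using 2 by linarith
      ultimately show ?thesis using ne True by (simp add: c s_def)
    next
      case False
      then have "rel_interior F \<inter> {x. h \<bullet> x = t} = {}"
        using rel_interior_meets_hyperplane_iff[OF face_of_imp_convex[OF F(1)] vw(3,4)]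
        by (auto simp: a_def b_def)
      then show ?thesis using False by (auto simp: c)
    qed
    let ?I = "{t \<in> T. a < t \<and> t < b}"
    have "(\<Sum>t\<in>T. c t) = - s * int (card ?I)"
      unfolding cF using finT by (simp add: sum.If_cases Int_def)
    \<comment> \<open>The gaps between \<open>a\<close> and \<open>b\<close> are those just above a
      level \<open>t\<close> with \<open>a \<le> t < b\<close>: the inner levels and
      \<open>a\<close> itself. This extra gap is what leaves one copy of \<open>s\<close>.\<close>
    moreover have "(\<Sum>t\<in>T - {Max T}. c (m t)) = - s * int (card (insert a ?I))"
    proof -
      have "c (m t) = (if a \<le> t \<and> t < b then - s else 0)" if t: "t \<in> T - {Max T}" for t
      proof -
        have "m t < b \<longleftrightarrow> t < b" using m(1)[OF t bT] m(2)[OF t] bT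
          by (cases "m t = b") auto
        then show ?thesis unfolding cF using m(1)[OF t aT] by auto
      qed
      then have "(\<Sum>t\<in>T - {Max T}. c (m t))
        = (\<Sum>t\<in>T - {Max T}. if a \<le> t \<and> t < b then - s else 0)"
        by (intro sum.cong) auto
      also have "\<dots> = - s * int (card {t \<in> T - {Max T}. a \<le> t \<and> t < b})"
        using finT by (simp add: sum.If_cases Int_def)
      also have "{t \<in> T - {Max T}. a \<le> t \<and> t < b} = insert a ?I"
        using aT ab bT Max_ge[OF finT bT] by auto
      finally show ?thesis .
    qed
    moreover have "card (insert a ?I) = Suc (card ?I)" using finT by simp
    ultimately show ?thesis by (simp add: s_def algebra_simps)
  qed
qed

text \<open>Each slice at a level or in a gap is a nonempty polytope of smaller dimension and has
  value 1 by induction. There is one level more than there are gaps, so the difference of the two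
  sums is 1; regrouped by faces, the same difference is \<open>euler_char P\<close>.\<close>

theorem euler_char_polytope:
  fixes P :: "'a::euclidean_space set"
  assumes "polytope P" "P \<noteq> {}"
  shows "euler_char P = 1"
  using assms
proof (induction "nat (aff_dim P)" arbitrary: P rule: less_induct)
  case less
  note P = \<open>polytope P\<close> \<open>P \<noteq> {}\<close>
  have PP: "P face_of P" using P by (simp add: face_of_refl polytope_imp_convex)
  have "aff_dim P \<ge> 0" using P(2) aff_dim_geq[of P] aff_dim_empty[of P] by linarith
  then consider "aff_dim P = 0" | "aff_dim P \<ge> 1" by linarith
  then show ?case
  proof cases
    case 1
    then obtain v where v: "P = {v}" using aff_dim_eq_0 by blast
    have "{F. F face_of P \<and> F \<noteq> {}} = {P}"
      using PP v face_of_imp_subset by blast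
    then show ?thesis by (simp add: euler_char_def 1)
  next
    case 2
    obtain h where inj: "inj_on (\<lambda>x. h \<bullet> x) {x. x extreme_point_of P}"
      using exists_injective_functional[OF finite_extreme_points[OF P(1)]] by blast
    define T where "T = (\<lambda>x. h \<bullet> x) ` {x. x extreme_point_of P}"
    have finT: "finite T" using T_def finite_extreme_points[OF P(1)] by simp
    obtain m where m: "\<And>t a. t \<in> T - {Max T} \<Longrightarrow> a \<in> T \<Longrightarrow> a < m t \<longleftrightarrow> a \<le> t"
      "\<And>t. t \<in> T - {Max T} \<Longrightarrow> m t \<notin> T"
      using finite_real_set_gaps[OF finT] by metis
    obtain v w where vw: "v extreme_point_of P" "w extreme_point_of P"
      "(\<lambda>x. h \<bullet> x) ` P = {h \<bullet> v .. h \<bullet> w}" "h \<bullet> v < h \<bullet> w"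
      using face_functional_range[OF P(1) PP 2 inj] by blast
    have vT: "h \<bullet> v \<in> T" and wT: "h \<bullet> w \<in> T" using vw by (auto simp: T_def)
    have Tsub: "T \<subseteq> {h \<bullet> v .. h \<bullet> w}"
      unfolding vw(3)[symmetric] by (auto simp: T_def extreme_point_of_def)
    have level: "euler_char (P \<inter> {x. h \<bullet> x = t}) = 1" if t: "t \<in> {h \<bullet> v .. h \<bullet> w}" for t
    proof -
      let ?H = "{x. h \<bullet> x = t}"
      have ne: "P \<inter> ?H \<noteq> {}" using t unfolding vw(3)[symmetric] by auto
      have poly: "polytope (P \<inter> ?H)"
        using P(1) polytope_Int_polyhedron polyhedron_hyperplane by blast
      have "\<not> P \<subseteq> ?H"
      proof
        assume "P \<subseteq> ?H"
        then have "(\<lambda>x. h \<bullet> x) ` P \<subseteq> {t}" by auto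
        then have "{h \<bullet> v .. h \<bullet> w} \<subseteq> {t}" unfolding vw(3) .
        moreover have "h \<bullet> v \<in> {h \<bullet> v .. h \<bullet> w}" "h \<bullet> w \<in> {h \<bullet> v .. h \<bullet> w}"
          using vw(4) by simp_all
        ultimately have "h \<bullet> v = t" "h \<bullet> w = t" by blast+
        then show False using vw(4) by simp
      qed
      then have "\<not> affine hull P \<subseteq> ?H" by (meson hull_subset order_trans)
      then have "aff_dim (affine hull P \<inter> ?H) < aff_dim P"
        using 2 aff_dim_affine_Int_hyperplane[of "affine hull P" h t] by auto
      moreover have "aff_dim (P \<inter> ?H) \<le> aff_dim (affine hull P \<inter> ?H)"
        by (rule aff_dim_subset) (auto intro: hull_inc)
      ultimately have "nat (aff_dim (P \<inter> ?H)) < nat (aff_dim P)" using 2 by linarith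
      then show ?thesis using less.hyps poly ne by blast
    qed
    define c where "c F t = (if rel_interior F \<inter> {x. h \<bullet> x = t} = {} then 0
        else (-1) ^ nat (aff_dim (F \<inter> {x. h \<bullet> x = t})) :: int)" for F t
    let ?faces = "{F. F face_of P \<and> F \<noteq> {}}"
    have sec: "(\<Sum>F\<in>?faces. c F t) = 1" if "t \<in> {h \<bullet> v .. h \<bullet> w}" for t
      using level[OF that] euler_char_section[OF P(1), of h t] by (simp add: c_def)
    have "(\<Sum>t\<in>T. \<Sum>F\<in>?faces. c F t) = (\<Sum>t\<in>T. 1)"
      by (rule sum.cong) (use sec Tsub in auto)
    moreover have "(\<Sum>t\<in>T - {Max T}. \<Sum>F\<in>?faces. c F (m t)) = (\<Sum>t\<in>T - {Max T}. 1)"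
    proof (rule sum.cong[OF refl])
      fix t assume t: "t \<in> T - {Max T}"
      have tw: "t < h \<bullet> w"
      proof -
        have "Max T = h \<bullet> w" by (rule Max_eqI[OF finT]) (use Tsub wT in auto)
        then show ?thesis using t Tsub by (force simp: order_less_le)
      qed
      have "h \<bullet> v < m t" using m(1)[OF t vT] t Tsub by auto
      moreover have "m t \<le> h \<bullet> w" using m(1)[OF t wT] tw by auto
      ultimately show "(\<Sum>F\<in>?faces. c F (m t)) = 1" by (intro sec) auto
    qed
    moreover have "card T = Suc (card (T - {Max T}))"
      using finT vT by (metis Max_in card_Suc_Diff1 empty_iff)
    ultimately have "(\<Sum>t\<in>T. \<Sum>F\<in>?faces. c F t) - (\<Sum>t\<in>T - {Max T}. \<Sum>F\<in>?faces. c F (m t)) = 1"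
      by simp
    then have "(\<Sum>F\<in>?faces. (\<Sum>t\<in>T. c F t) - (\<Sum>t\<in>T - {Max T}. c F (m t))) = 1"
      by (simp add: sum_subtractf sum.swap[of _ T] sum.swap[of _ "T - {Max T}"])
    moreover have "(\<Sum>t\<in>T. c F t) - (\<Sum>t\<in>T - {Max T}. c F (m t)) = (-1) ^ nat (aff_dim F)"
      if "F \<in> ?faces" for F
      using that face_level_gap_count[OF P(1) _ _ inj T_def m, of F "c F"] by (simp add: c_def)
    ultimately show ?thesis by (simp add: euler_char_def)
  qed
qed

section \<open>The Euler relation in terms of face numbers\<close>

lemma euler_char_face_counts:
  fixes P :: "'a::euclidean_space set"
  assumes P: "polytope P" and d: "aff_dim P = int d"
  shows "euler_char P = (\<Sum>k\<le>d. (-1) ^ k * int (face_count k P))"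
proof -
  let ?faces = "{F. F face_of P \<and> F \<noteq> {}}"
  have dim: "0 \<le> aff_dim F" "aff_dim F \<le> int d" if "F \<in> ?faces" for F
    using that aff_dim_geq[of F] aff_dim_empty[of F] aff_dim_subset[OF face_of_imp_subset[of F P]] d
    by simp_all
  have "euler_char P = (\<Sum>k\<le>d. \<Sum>F\<in>{F \<in> ?faces. nat (aff_dim F) = k}. (-1) ^ nat (aff_dim F))"
    unfolding euler_char_def
    by (rule sum.group[symmetric, OF finite_nonempty_faces[OF P]]) (use dim in force)+
  also have "\<dots> = (\<Sum>k\<le>d. (-1) ^ k * int (face_count k P))"
  proof (rule sum.cong[OF refl])
    fix k
    have "F \<noteq> {} \<and> nat (aff_dim F) = k \<longleftrightarrow> aff_dim F = int k" for F :: "'a set"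
      using aff_dim_geq[of F] aff_dim_empty[of F] by (cases "F = {}") auto
    then have "{F \<in> ?faces. nat (aff_dim F) = k} = {F. F face_of P \<and> aff_dim F = int k}"
      by blast
    then show "(\<Sum>F\<in>{F \<in> ?faces. nat (aff_dim F) = k}. (-1) ^ nat (aff_dim F))
      = (-1) ^ k * int (face_count k P)"
      by (simp add: face_count_def)
  qed
  finally show ?thesis .
qed

lemma face_count_top:
  fixes P :: "'a::euclidean_space set"
  assumes "polytope P" "aff_dim P = int d"
  shows "face_count d P = 1"
proof -
  have "P face_of P" using assms by (simp add: face_of_refl polytope_imp_convex)
  then have "{F. F face_of P \<and> aff_dim F = int d} = {P}"
    using face_of_aff_dim_lt[of P] assms polytope_imp_convex by force
  then show ?thesis by (simp add: face_count_def)
qed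

text \<open>The polygon is its only two-dimensional face, so the Euler relation reads f_0 - f_1 + 1
  = 1.\<close>

lemma polygon_edges_eq_vertices:
  fixes P :: "'a::euclidean_space set"
  assumes "polytope P" "aff_dim P = 2"
  shows "face_count 1 P = face_count 0 P"
  using euler_char_face_counts[of P 2] euler_char_polytope[of P] face_count_top[of P 2] assms
  by (force simp: eval_nat_numeral)

lemma euler_polyhedron_formula:
  fixes P :: "'a::euclidean_space set"
  assumes "polytope P" "aff_dim P = 3"
  shows "int (face_count 0 P) - int (face_count 1 P) + int (face_count 2 P) = 2"
  using euler_char_face_counts[of P 3] euler_char_polytope[of P] face_count_top[of P 3] assms
  by (force simp: eval_nat_numeral)

subsection \<open>Facets through a ridge\<close>

text \<open>Used on a linear relation among three facet normals: evaluation at a point where one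
  normal vanishes and the others are negative compares the other two coefficients.\<close>

lemma opposite_signs:
  fixes u v p q :: real
  assumes "u * p + v * q = 0" "p < 0" "q < 0"
  shows "(0 < u \<longleftrightarrow> v < 0) \<and> (u < 0 \<longleftrightarrow> 0 < v)"
proof -
  have "u * p = - (v * q)" using assms(1) by linarith
  then have "u = - v * q / p" using assms(2) by (simp add: field_simps)
  moreover have "q / p > 0" using assms by (simp add: zero_less_divide_iff)
  moreover have "- v * q / p = - v * (q / p)" by simp
  ultimately show ?thesis by (metis mult_less_0_iff neg_0_less_iff_less neg_less_0_iff_less
        not_less_iff_gr_or_eq zero_less_mult_iff)
qed

lemma facet_supporting_hyperplane:
  fixes P :: "'a::euclidean_space set"
  assumes "polyhedron P" "F facet_of P"
  obtains a b where "a \<noteq> 0" "P \<subseteq> {x. a \<bullet> x \<le> b}" "F = P \<inter> {x. a \<bullet> x = b}"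
proof -
  have "F exposed_face_of P" "F \<noteq> {}" "F \<noteq> P"
    using assms exposed_face_of_polyhedron facet_of_imp_face_of facet_of_irrefl
    unfolding facet_of_def by auto
  then show ?thesis using that unfolding exposed_face_of by blast
qed

text \<open>The normals of facets through \<open>E\<close> are orthogonal to its directions. If
  \<open>E\<close> had codimension 2, three such normals would lie in a plane and satisfy a
  nontrivial linear relation. Evaluated at relative interior points of the three facets, the
  relation forces its coefficients to have pairwise opposite signs, which three numbers can only do
  by vanishing.\<close>

lemma three_facets_inter_aff_dim:
  fixes P :: "'a::euclidean_space set"
  assumes P: "polyhedron P" and FF: "\<And>i. i < (3::nat) \<Longrightarrow> F i facet_of P"
    and neq: "inj_on F {..<3}"
    and E: "E \<noteq> {}" "\<And>i. i < 3 \<Longrightarrow> E \<subseteq> F i"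
  shows "aff_dim E \<noteq> int DIM('a) - 2"
proof
  assume dimE: "aff_dim E = int DIM('a) - 2"
  have "\<exists>a b. a \<noteq> 0 \<and> P \<subseteq> {x. a \<bullet> x \<le> b} \<and> F i = P \<inter> {x. a \<bullet> x = b}" if "i < 3" for i
    using facet_supporting_hyperplane[OF P FF[OF that]] by metis
  then obtain a b where ab: "\<And>i. i < 3 \<Longrightarrow> P \<subseteq> {x. a i \<bullet> x \<le> b i}"
      "\<And>i. i < 3 \<Longrightarrow> F i = P \<inter> {x. a i \<bullet> x = b i}"
    by metis
  obtain x where x: "x \<in> E" using E by auto
  have xb: "a i \<bullet> z = b i" if "i < 3" "z \<in> E" for i z
    using ab(2)[OF that(1)] E(2)[OF that(1)] that(2) by auto
  have "\<exists>y. y \<in> rel_interior (F i)" if "i < 3" for i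
    using FF[OF that] face_of_imp_convex rel_interior_eq_empty unfolding facet_of_def by blast
  then obtain y where y: "\<And>i. i < 3 \<Longrightarrow> y i \<in> rel_interior (F i)" by metis
  have yF: "y i \<in> F i" if "i < 3" for i using y[OF that] rel_interior_subset by blast
  have neg: "a j \<bullet> (y i - x) < 0" if ij: "i < 3" "j < 3" "i \<noteq> j" for i j
  proof -
    \<comment> \<open>A face containing a relative interior point of \<open>F i\<close> contains all
      of \<open>F i\<close>, and by equal dimension it would coincide with it.\<close>
    have "y i \<notin> F j"
    proof
      assume "y i \<in> F j"
      then have sub: "F i \<subseteq> F j"
        using subset_of_face_of[of "F j" P "F i"] FF ij y facet_of_imp_face_of facet_of_imp_subset
        by blast
      then have "F i face_of F j"
        using FF ij facet_of_imp_face_of facet_of_imp_subset face_of_subset by metis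
      moreover have "convex (F j)" using FF ij facet_of_imp_face_of face_of_imp_convex by blast
      moreover have "aff_dim (F i) = aff_dim (F j)" using FF ij by (simp add: facet_of_def)
      ultimately have "F i = F j" using face_of_aff_dim_lt by fastforce
      then show False using neq ij by (auto dest: inj_onD)
    qed
    moreover have "y i \<in> P" using yF[OF ij(1)] FF[OF ij(1)] facet_of_imp_subset by blast
    ultimately have "a j \<bullet> y i < b j" using ab[OF ij(2)] by force
    then show ?thesis using xb[OF ij(2) x] by (simp add: inner_diff_right)
  qed
  have zero: "a i \<bullet> (y i - x) = 0" if "i < 3" for i
    using yF[OF that] ab(2)[OF that] xb[OF that x] by (simp add: inner_diff_right)
  have inja: "inj_on a {..<3}"
    using neg zero by (intro inj_onI) (metis lessThan_iff less_irrefl)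
  define S where "S = (\<lambda>z. z - x) ` E"
  \<comment> \<open>The orthogonal complement of the direction space of \<open>E\<close>, of
    dimension 2 because \<open>E\<close> has codimension 2.\<close>
  define W where "W = {w \<in> UNIV. \<forall>z\<in>span S. orthogonal z w}"
  have "aff_dim E = int (dim S)" unfolding S_def
    by (rule aff_dim_eq_dim_subtract) (rule hull_inc[OF x])
  moreover have "dim W + dim (span S) = dim (UNIV :: 'a set)" unfolding W_def
    by (rule dim_subspace_orthogonal_to_vectors) auto
  ultimately have dimW: "dim W = 2" using dimE by simp
  have "a i \<in> W" if "i < 3" for i
  proof -
    have "orthogonal (a i) z" if "z \<in> span S" for z
      using that
    proof (rule orthogonal_to_span)
      fix z assume "z \<in> S"
      then show "orthogonal (a i) z"
        using xb[OF \<open>i < 3\<close>] x by (auto simp: S_def orthogonal_def inner_diff_right)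
    qed
    then show ?thesis by (simp add: W_def orthogonal_commute)
  qed
  then have sub: "a ` {..<3} \<subseteq> W" by auto
  have "dependent (a ` {..<3})"
  proof (rule ccontr)
    assume "\<not> dependent (a ` {..<3})"
    then have "card (a ` {..<3}) \<le> dim W" using sub independent_card_le_dim by blast
    then show False using dimW card_image[OF inja] by simp
  qed
  then obtain u where u: "\<exists>v\<in>a ` {..<3}. u v \<noteq> 0" "(\<Sum>v\<in>a ` {..<3}. u v *\<^sub>R v) = 0"
    using dependent_finite[of "a ` {..<3}"] by auto
  define w where "w i = u (a i)" for i
  have "(\<Sum>i<3. w i *\<^sub>R a i) = 0" using u(2) by (simp add: sum.reindex[OF inja] w_def)
  then have "(\<Sum>i<3. w i *\<^sub>R a i) \<bullet> z = 0" for z by simp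
  then have rel: "(\<Sum>i<3. w i * (a i \<bullet> z)) = 0" for z
    by (simp add: inner_sum_left)
  \<comment> \<open>At \<open>y 0 - x\<close> the term of \<open>a 0\<close> drops out and the other
    two inner products are negative; the next two steps permute the roles.\<close>
  have "(0 < w 1 \<longleftrightarrow> w 2 < 0) \<and> (w 1 < 0 \<longleftrightarrow> 0 < w 2)"
    by (rule opposite_signs[of _ "a 1 \<bullet> (y 0 - x)" _ "a 2 \<bullet> (y 0 - x)"])
      (use rel[of "y 0 - x"] zero[of 0] neg in \<open>simp_all add: eval_nat_numeral\<close>)
  moreover have "(0 < w 0 \<longleftrightarrow> w 2 < 0) \<and> (w 0 < 0 \<longleftrightarrow> 0 < w 2)"
    by (rule opposite_signs[of _ "a 0 \<bullet> (y 1 - x)" _ "a 2 \<bullet> (y 1 - x)"])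
      (use rel[of "y 1 - x"] zero[of 1] neg in \<open>simp_all add: eval_nat_numeral\<close>)
  moreover have "(0 < w 0 \<longleftrightarrow> w 1 < 0) \<and> (w 0 < 0 \<longleftrightarrow> 0 < w 1)"
    by (rule opposite_signs[of _ "a 0 \<bullet> (y 2 - x)" _ "a 1 \<bullet> (y 2 - x)"])
      (use rel[of "y 2 - x"] zero[of 2] neg in \<open>simp_all add: eval_nat_numeral\<close>)
  ultimately have "w 0 = 0 \<and> w 1 = 0 \<and> w 2 = 0" by linarith
  moreover obtain i where "i < 3" "w i \<noteq> 0" using u(1) by (auto simp: w_def)
  moreover from \<open>i < 3\<close> have "i = 0 \<or> i = 1 \<or> i = 2" by linarith
  ultimately show False by auto
qed

text \<open>\<open>E\<close> is the intersection of the facets containing it. No facet would give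
  the whole space and a single one would give codimension 1; three or more are excluded by
  \<open>three_facets_inter_aff_dim\<close>.\<close>

lemma card_facets_containing_ridge:
  fixes P :: "'a::euclidean_space set"
  assumes P: "polytope P" "aff_dim P = int DIM('a)"
    and E: "E face_of P" "E \<noteq> {}" "aff_dim E = int DIM('a) - 2"
  shows "card {F. F facet_of P \<and> E \<subseteq> F} = 2"
proof -
  let ?K = "{F. F facet_of P \<and> E \<subseteq> F}"
  have poly: "polyhedron P" using P polytope_imp_polyhedron by blast
  have fin: "finite ?K"
    by (rule finite_subset[OF _ finite_polytope_faces[OF P(1)]]) (auto simp: facet_of_imp_face_of)
  have EK: "E = \<Inter>?K"
    by (rule face_of_polyhedron[OF poly E(1,2)]) (use P E in auto)
  have "card ?K \<noteq> 0"
  proof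
    assume "card ?K = 0"
    then have "?K = {}" using fin by simp
    then have "E = UNIV" using EK by (metis Inter_empty)
    then show False using E by simp
  qed
  moreover have "card ?K \<noteq> 1"
  proof
    assume "card ?K = 1"
    then obtain F where F: "?K = {F}" by (meson card_1_singletonE)
    then have "E = F" using EK by (metis cInf_singleton)
    moreover have "F facet_of P" using F by blast
    ultimately show False using E P by (simp add: facet_of_def)
  qed
  moreover have "\<not> card ?K \<ge> 3"
  proof
    assume "card ?K \<ge> 3"
    then obtain T where T: "T \<subseteq> ?K" "card T = 3" "finite T"
      by (rule obtain_subset_with_card_n)
    then obtain F where "bij_betw F {..<3::nat} T"
      using ex_bij_betw_nat_finite[OF T(3)] by (auto simp: lessThan_atLeast0)
    then have F: "inj_on F {..<3}" "F ` {..<3} = T" by (auto simp: bij_betw_def)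
    have "F i facet_of P \<and> E \<subseteq> F i" if "i < 3" for i
    proof -
      have "F i \<in> ?K" using F(2) T(1) that by (metis imageI lessThan_iff subsetD)
      then show ?thesis by simp
    qed
    then show False using three_facets_inter_aff_dim[OF poly _ F(1) E(2)] E(3) by blast
  qed
  ultimately show ?thesis by linarith
qed

text \<open>Double counting of incident pairs of an edge and a facet, where a polygonal facet has as
  many edges as vertices.\<close>

lemma sum_facet_vertices:
  fixes P :: "(real ^ 3) set"
  assumes P: "polytope P" "aff_dim P = 3"
  shows "(\<Sum>F | F face_of P \<and> aff_dim F = 2. 4 - int (face_count 0 F))
    = 4 * int (face_count 2 P) - 2 * int (face_count 1 P)"
proof -
  let ?F = "{F. F face_of P \<and> aff_dim F = 2}" and ?E = "{E. E face_of P \<and> aff_dim E = 1}"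
  have fin: "finite ?F" "finite ?E"
    by (rule finite_subset[OF _ finite_polytope_faces[OF P(1)]]; auto)+
  have facet: "F facet_of P \<longleftrightarrow> F \<in> ?F" for F
    using P by (auto simp: facet_of_def)
  have "card {F \<in> ?F. E \<subseteq> F} = 2" if "E \<in> ?E" for E
  proof -
    have "{F \<in> ?F. E \<subseteq> F} = {F. F facet_of P \<and> E \<subseteq> F}" using facet by blast
    moreover have "E \<noteq> {}" using that by auto
    ultimately show ?thesis using card_facets_containing_ridge[OF P(1), of E] that P by simp
  qed
  then have "(\<Sum>F\<in>?F. card {E \<in> ?E. E \<subseteq> F}) = 2 * card ?E"
    by (intro sum_multicount fin) auto
  moreover have "card {E \<in> ?E. E \<subseteq> F} = face_count 0 F" if F: "F \<in> ?F" for F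
  proof -
    have "{E \<in> ?E. E \<subseteq> F} = {E. E face_of F \<and> aff_dim E = int 1}"
      using F face_of_face by auto
    then have "card {E \<in> ?E. E \<subseteq> F} = face_count 1 F" by (simp add: face_count_def)
    also have "\<dots> = face_count 0 F"
      using polygon_edges_eq_vertices[of F] face_of_polytope_polytope[OF P(1)] F by blast
    finally show ?thesis .
  qed
  ultimately have "(\<Sum>F\<in>?F. face_count 0 F) = 2 * face_count 1 P"
    by (simp add: face_count_def)
  then have "int (\<Sum>F\<in>?F. face_count 0 F) = int (2 * face_count 1 P)" by (rule arg_cong)
  then show ?thesis by (simp add: sum_subtractf face_count_def)
qed

subsection \<open>Vertices of Minkowski sums\<close>

lemma face_count_0_eq_card_extreme_points:
  "face_count 0 P = card {x. x extreme_point_of P}"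
proof -
  have "{F. F face_of P \<and> aff_dim F = int 0} = (\<lambda>x. {x}) ` {x. x extreme_point_of P}"
    by (auto simp: aff_dim_eq_0 face_of_singleton)
  then show ?thesis by (simp add: face_count_def card_image)
qed

text \<open>The directions of \<open>A + B\<close> lie in the sum of \<open>U\<close> and
  \<open>V\<close>. Keeping the intersection term makes equality of dimensions force
  \<open>U\<close> and \<open>V\<close> to meet only in 0.\<close>

lemma aff_dim_set_plus_span:
  fixes A B :: "'a::euclidean_space set"
  assumes "a0 \<in> A" "b0 \<in> B"
  defines "U \<equiv> span ((\<lambda>x. x - a0) ` A)" and "V \<equiv> span ((\<lambda>x. x - b0) ` B)"
  shows "aff_dim (A + B) + int (dim (U \<inter> V)) \<le> aff_dim A + aff_dim B"
proof -
  have sub: "subspace U" "subspace V" by (auto simp: U_def V_def)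
  have "aff_dim A = int (dim U)" "aff_dim B = int (dim V)"
    unfolding U_def V_def dim_span
    by (simp_all add: aff_dim_eq_dim_subtract[OF hull_inc] assms(1,2))
  moreover have "aff_dim (A + B) = int (dim ((\<lambda>x. x - (a0 + b0)) ` (A + B)))"
    by (rule aff_dim_eq_dim_subtract) (intro hull_inc set_plus_intro assms)
  moreover have "(\<lambda>x. x - (a0 + b0)) ` (A + B) \<subseteq> {x + y | x y. x \<in> U \<and> y \<in> V}"
  proof clarify
    fix x assume "x \<in> A + B"
    then obtain a b where ab: "x = a + b" "a \<in> A" "b \<in> B" by (rule set_plus_elim)
    have "x - (a0 + b0) = (a - a0) + (b - b0)" using ab by simp
    moreover have "a - a0 \<in> U" "b - b0 \<in> V"
      using ab by (auto simp: U_def V_def intro!: span_base)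
    ultimately show "\<exists>u v. x - (a0 + b0) = u + v \<and> u \<in> U \<and> v \<in> V" by blast
  qed
  then have "dim ((\<lambda>x. x - (a0 + b0)) ` (A + B)) \<le> dim {x + y | x y. x \<in> U \<and> y \<in> V}"
    by (rule dim_subset)
  ultimately show ?thesis using dim_sums_Int[OF sub] by linarith
qed

lemma aff_dim_set_plus_le:
  fixes A B :: "'a::euclidean_space set"
  assumes "A \<noteq> {}" "B \<noteq> {}"
  shows "aff_dim (A + B) \<le> aff_dim A + aff_dim B"
  using assms aff_dim_set_plus_span[of _ A _ B] by (smt (verit) ex_in_conv of_nat_0_le_iff)

text \<open>The direction spaces meet only in 0, so a point of \<open>A + B\<close> splits uniquely,
  and the splitting respects affine combinations. Hence the extreme points of the sum are exactly
  the sums of extreme points.\<close>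

lemma vertices_exact_set_plus:
  fixes A B :: "'a::euclidean_space set"
  assumes ne: "A \<noteq> {}" "B \<noteq> {}" and dim: "aff_dim (A + B) = aff_dim A + aff_dim B"
  shows "face_count 0 (A + B) = face_count 0 A * face_count 0 B"
proof -
  obtain a0 b0 where a0: "a0 \<in> A" "b0 \<in> B" using ne by auto
  define U where "U = span ((\<lambda>x. x - a0) ` A)"
  define V where "V = span ((\<lambda>x. x - b0) ` B)"
  have sub: "subspace U" "subspace V" by (auto simp: U_def V_def)
  have "dim (U \<inter> V) = 0" using aff_dim_set_plus_span[OF a0] dim unfolding U_def V_def by linarith
  then have UV: "U \<inter> V \<subseteq> {0}" by simp
  have U: "a - a0 \<in> U" if "a \<in> A" for a using that by (auto simp: U_def intro!: span_base)
  have V: "b - b0 \<in> V" if "b \<in> B" for b using that by (auto simp: V_def intro!: span_base)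
  \<comment> \<open>The errors \<open>u\<close> and \<open>v\<close> of the two claimed equations
    lie in \<open>U\<close> and \<open>V\<close> and add up to 0, so both lie in the trivial
    intersection.\<close>
  have split: "a = (1 - t) *\<^sub>R a1 + t *\<^sub>R a2 \<and> b = (1 - t) *\<^sub>R b1 + t *\<^sub>R b2"
    if "a \<in> A" "a1 \<in> A" "a2 \<in> A" "b \<in> B" "b1 \<in> B" "b2 \<in> B"
      and eq: "a + b = (1 - t) *\<^sub>R (a1 + b1) + t *\<^sub>R (a2 + b2)" for a a1 a2 b b1 b2 t
  proof -
    define u where "u = (a - a0) - ((1 - t) *\<^sub>R (a1 - a0) + t *\<^sub>R (a2 - a0))"
    define v where "v = (b - b0) - ((1 - t) *\<^sub>R (b1 - b0) + t *\<^sub>R (b2 - b0))"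
    have u: "u \<in> U" unfolding u_def
      by (intro subspace_diff subspace_add subspace_scale sub U that)
    have v: "v \<in> V" unfolding v_def
      by (intro subspace_diff subspace_add subspace_scale sub V that)
    have ue: "u = a - ((1 - t) *\<^sub>R a1 + t *\<^sub>R a2)" by (simp add: u_def algebra_simps)
    have ve: "v = b - ((1 - t) *\<^sub>R b1 + t *\<^sub>R b2)" by (simp add: v_def algebra_simps)
    have "u + v = (a + b) - ((1 - t) *\<^sub>R (a1 + b1) + t *\<^sub>R (a2 + b2))"
      by (simp add: ue ve algebra_simps)
    then have "u + v = 0" using eq by simp
    then have "u = - v" by (simp add: eq_neg_iff_add_eq_0)
    then have "u \<in> V" using v sub(2) subspace_neg by blast
    then have "u = 0" using u UV by blast
    then have "v = 0" using \<open>u = - v\<close> by simp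
    then show ?thesis using \<open>u = 0\<close> ue ve by simp
  qed
  let ?A = "{x. x extreme_point_of A}" and ?B = "{x. x extreme_point_of B}"
  have "inj_on (\<lambda>(a, b). a + b) (?A \<times> ?B)"
  proof (rule inj_onI, clarify)
    fix a b a' b' assume "a extreme_point_of A" "b extreme_point_of B"
      "a' extreme_point_of A" "b' extreme_point_of B" and eq: "a + b = a' + b'"
    then have "a \<in> A" "b \<in> B" "a' \<in> A" "b' \<in> B" by (auto simp: extreme_point_of_def)
    \<comment> \<open>With \<open>t = 0\<close>, \<open>split\<close> is uniqueness of the two
      summands.\<close>
    then show "a = a' \<and> b = b'" using split[of a a' a' b b' b' 0] eq by simp
  qed
  moreover have "{x. x extreme_point_of (A + B)} = (\<lambda>(a, b). a + b) ` (?A \<times> ?B)"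
  proof (intro subset_antisym subsetI)
    fix x assume "x \<in> {x. x extreme_point_of (A + B)}"
    then have x: "x \<in> A + B" "\<And>p q. p \<in> A + B \<Longrightarrow> q \<in> A + B \<Longrightarrow> x \<notin> open_segment p q"
      by (auto simp: extreme_point_of_def)
    obtain a b where ab: "x = a + b" "a \<in> A" "b \<in> B" using x(1) by (rule set_plus_elim)
    have "a \<notin> open_segment p q" if "p \<in> A" "q \<in> A" for p q
      using x(2)[OF set_plus_intro[OF that(1) ab(3)] set_plus_intro[OF that(2) ab(3)]]
      unfolding ab(1) using open_segment_translation_eq[of b a p q] by (simp add: add.commute)
    moreover have "b \<notin> open_segment p q" if "p \<in> B" "q \<in> B" for p q
      using x(2)[OF set_plus_intro[OF ab(2) that(1)] set_plus_intro[OF ab(2) that(2)]]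
      unfolding ab(1) using open_segment_translation_eq[of a b p q] by simp
    ultimately have "a extreme_point_of A" "b extreme_point_of B"
      using ab by (auto simp: extreme_point_of_def)
    then show "x \<in> (\<lambda>(a, b). a + b) ` (?A \<times> ?B)" using ab by force
  next
    fix x assume "x \<in> (\<lambda>(a, b). a + b) ` (?A \<times> ?B)"
    then obtain a b where ab: "x = a + b" "a extreme_point_of A" "b extreme_point_of B" by auto
    then have mem: "a \<in> A" "b \<in> B" by (auto simp: extreme_point_of_def)
    have "x \<notin> open_segment p q" if pq: "p \<in> A + B" "q \<in> A + B" for p q
    proof
      assume seg: "x \<in> open_segment p q"
      obtain a1 b1 where 1: "p = a1 + b1" "a1 \<in> A" "b1 \<in> B" using pq(1) by (rule set_plus_elim)
      obtain a2 b2 where 2: "q = a2 + b2" "a2 \<in> A" "b2 \<in> B" using pq(2) by (rule set_plus_elim)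
      obtain t where t: "0 < t" "t < 1" "p \<noteq> q" "x = (1 - t) *\<^sub>R p + t *\<^sub>R q"
        using seg by (auto simp: in_segment)
      have e: "a = (1 - t) *\<^sub>R a1 + t *\<^sub>R a2" "b = (1 - t) *\<^sub>R b1 + t *\<^sub>R b2"
        using split[OF mem(1) 1(2) 2(2) mem(2) 1(3) 2(3), of t] t(4) ab(1) 1(1) 2(1) by auto
      have "a1 = a2"
        using ab(2) 1(2) 2(2) e(1) t(1,2) unfolding extreme_point_of_def in_segment by blast
      moreover have "b1 = b2"
        using ab(3) 1(3) 2(3) e(2) t(1,2) unfolding extreme_point_of_def in_segment by blast
      ultimately show False using 1 2 t(3) by simp
    qed
    then have "x extreme_point_of (A + B)"
      using ab mem by (auto simp: extreme_point_of_def)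
    then show "x \<in> {x. x extreme_point_of (A + B)}" by simp
  qed
  ultimately show ?thesis
    by (simp add: face_count_0_eq_card_extreme_points card_image card_cartesian_product)
qed

section \<open>Minkowski sums of finite families\<close>

lemma polytope_set_plus:
  fixes A B :: "'a::euclidean_space set"
  assumes "polytope A" "polytope B"
  shows "polytope (A + B)"
proof -
  obtain S T where "finite S" "A = convex hull S" "finite T" "B = convex hull T"
    using assms by (auto simp: polytope_def)
  then have "A + B = convex hull (S + T)" "finite (S + T)"
    by (auto simp: convex_hull_set_plus finite_set_plus)
  then show ?thesis using polytope_convex_hull by metis
qed

lemma polytope_set_sum:
  fixes G :: "'i \<Rightarrow> 'a::euclidean_space set"
  assumes "finite I" "\<And>i. i \<in> I \<Longrightarrow> polytope (G i)"
  shows "polytope (\<Sum>i\<in>I. G i)"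
  using assms by (induction I) (auto simp: polytope_set_plus set_zero polytope_sing)

lemma set_sum_nonempty:
  fixes G :: "'i \<Rightarrow> 'a::comm_monoid_add set"
  assumes "finite I" "\<And>i. i \<in> I \<Longrightarrow> G i \<noteq> {}"
  shows "(\<Sum>i\<in>I. G i) \<noteq> {}"
proof -
  have "\<forall>i\<in>I. (SOME x. x \<in> G i) \<in> G i" using assms(2) by (simp add: some_in_eq)
  then show ?thesis using assms(1) by (auto simp: set_sum_alt)
qed

lemma aff_dim_set_sum_le:
  fixes G :: "'i \<Rightarrow> 'a::euclidean_space set"
  assumes "finite I" "\<And>i. i \<in> I \<Longrightarrow> G i \<noteq> {}"
  shows "aff_dim (\<Sum>i\<in>I. G i) \<le> (\<Sum>i\<in>I. aff_dim (G i))"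
  using assms
proof (induction I)
  case (insert i I)
  have "aff_dim (G i + (\<Sum>i\<in>I. G i)) \<le> aff_dim (G i) + aff_dim (\<Sum>i\<in>I. G i)"
    by (rule aff_dim_set_plus_le) (use insert set_sum_nonempty[of I G] in auto)
  then show ?case using insert by fastforce
qed (simp add: set_zero)

text \<open>Fixing a point \<open>z\<close> of the sum of the other members places a translate of
  \<open>G i\<close> inside the whole sum.\<close>

lemma aff_dim_le_set_sum:
  fixes G :: "'i \<Rightarrow> 'a::euclidean_space set"
  assumes I: "finite I" "i \<in> I" and ne: "\<And>i. i \<in> I \<Longrightarrow> G i \<noteq> {}"
  shows "aff_dim (G i) \<le> aff_dim (\<Sum>i\<in>I. G i)"
proof -
  have "(\<Sum>j\<in>I - {i}. G j) \<noteq> {}" using set_sum_nonempty[of "I - {i}" G] I ne by simp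
  then obtain z where z: "z \<in> (\<Sum>j\<in>I - {i}. G j)" by blast
  have "(+) z ` G i \<subseteq> G i + (\<Sum>j\<in>I - {i}. G j)"
    using z by (auto simp: add.commute[of z])
  also have "\<dots> = (\<Sum>i\<in>I. G i)" using I by (simp add: sum.remove)
  finally show ?thesis using aff_dim_subset aff_dim_translation_eq by metis
qed

text \<open>Exactness passes to the partial sum: by subadditivity of dimension, equality overall
  makes every intermediate inequality tight.\<close>

lemma vertices_exact_set_sum:
  fixes G :: "'i \<Rightarrow> 'a::euclidean_space set"
  assumes "finite I" "\<And>i. i \<in> I \<Longrightarrow> G i \<noteq> {}"
    and "aff_dim (\<Sum>i\<in>I. G i) = (\<Sum>i\<in>I. aff_dim (G i))"
  shows "face_count 0 (\<Sum>i\<in>I. G i) = (\<Prod>i\<in>I. face_count 0 (G i))"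
  using assms
proof (induction I)
  case empty
  have "face_count 0 {0::'a} = card {0::'a}"
    unfolding face_count_0_eq_card_extreme_points by simp
  then show ?case by (simp add: set_zero)
next
  case (insert i I)
  have ne: "G i \<noteq> {}" "(\<Sum>i\<in>I. G i) \<noteq> {}"
    using insert set_sum_nonempty[of I G] by auto
  have "aff_dim (\<Sum>i\<in>I. G i) \<le> (\<Sum>i\<in>I. aff_dim (G i))"
    using aff_dim_set_sum_le[of I G] insert by auto
  moreover have "aff_dim (G i + (\<Sum>i\<in>I. G i)) = aff_dim (G i) + (\<Sum>i\<in>I. aff_dim (G i))"
    using insert by simp
  moreover note aff_dim_set_plus_le[OF ne]
  ultimately have *: "aff_dim (\<Sum>i\<in>I. G i) = (\<Sum>i\<in>I. aff_dim (G i))"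
    "aff_dim (G i + (\<Sum>i\<in>I. G i)) = aff_dim (G i) + aff_dim (\<Sum>i\<in>I. G i)"
    by linarith+
  have "face_count 0 (\<Sum>i\<in>I. G i) = (\<Prod>i\<in>I. face_count 0 (G i))"
    by (rule insert.IH) (use insert.prems(1) *(1) in auto)
  then show ?case
    using vertices_exact_set_plus[OF ne *(2)] insert.hyps by simp
qed

lemma segment_vertices:
  fixes P :: "'a::euclidean_space set"
  assumes "polytope P" "aff_dim P = 1"
  shows "face_count 0 P = 2"
  using euler_char_face_counts[of P 1] euler_char_polytope[of P] face_count_top[of P 1] assms
  by (force simp: eval_nat_numeral)

text \<open>
  An exact two-dimensional sum is either a translate of one polygon or a parallelogram, whose
  four vertices make the left-hand side vanish.
\<close>

lemma exact_polygon_sum_vertices: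
  fixes G :: "'i \<Rightarrow> 'a::euclidean_space set"
  assumes I: "finite I" and G: "\<And>i. i \<in> I \<Longrightarrow> polytope (G i)" "\<And>i. i \<in> I \<Longrightarrow> G i \<noteq> {}"
    and dim: "aff_dim (\<Sum>i\<in>I. G i) = 2" "(\<Sum>i\<in>I. aff_dim (G i)) = 2"
  shows "4 - int (face_count 0 (\<Sum>i\<in>I. G i))
    = (\<Sum>i\<in>I. if aff_dim (G i) = 2 then 4 - int (face_count 0 (G i)) else 0)"
proof -
  have vert: "face_count 0 (\<Sum>i\<in>I. G i) = (\<Prod>i\<in>I. face_count 0 (G i))"
    using vertices_exact_set_sum[OF I G(2)] dim by simp
  have nonneg: "0 \<le> aff_dim (G i)" if "i \<in> I" for i
    using G(2)[OF that] aff_dim_geq[of "G i"] aff_dim_empty[of "G i"] by linarith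
  have v0: "face_count 0 (G i) = 1" if "i \<in> I" "aff_dim (G i) = 0" for i
    using face_count_top[of "G i" 0] G(1) that by simp
  have v1: "face_count 0 (G i) = 2" if "i \<in> I" "aff_dim (G i) = 1" for i
    using segment_vertices G(1) that by blast
  show ?thesis
  proof (cases "\<exists>i\<in>I. aff_dim (G i) = 2")
    case True
    then obtain i where i: "i \<in> I" "aff_dim (G i) = 2" by blast
    then have "(\<Sum>j\<in>I - {i}. aff_dim (G j)) = 0"
      using dim(2) I by (simp add: sum.remove)
    then have z: "aff_dim (G j) = 0" if "j \<in> I - {i}" for j
      using that nonneg I sum_nonneg_eq_0_iff[of "I - {i}" "\<lambda>j. aff_dim (G j)"] by auto
    have "(\<Prod>j\<in>I. face_count 0 (G j)) = face_count 0 (G i) * (\<Prod>j\<in>I - {i}. face_count 0 (G j))"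
      using I i by (simp add: prod.remove)
    also have "(\<Prod>j\<in>I - {i}. face_count 0 (G j)) = 1"
      by (rule prod.neutral) (use z v0 in auto)
    finally have "face_count 0 (\<Sum>i\<in>I. G i) = face_count 0 (G i)" using vert by simp
    moreover have "(\<Sum>j\<in>I - {i}. if aff_dim (G j) = 2 then 4 - int (face_count 0 (G j)) else 0) = 0"
      by (rule sum.neutral) (use z in auto)
    ultimately show ?thesis using I i by (simp add: sum.remove[of I i])
  next
    case False
    have le: "aff_dim (G i) \<le> 2" if "i \<in> I" for i
      using member_le_sum[of i I "\<lambda>j. aff_dim (G j)"] that nonneg I dim(2) by auto
    \<comment> \<open>Only points and segments remain, with 1 and 2 vertices, so the product is 2 to
      the total dimension 2.\<close>
    have "face_count 0 (G i) = 2 ^ nat (aff_dim (G i))" if i: "i \<in> I" for i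
    proof -
      have "aff_dim (G i) = 0 \<or> aff_dim (G i) = 1" using le[OF i] nonneg[OF i] False i by force
      then show ?thesis using v0[OF i] v1[OF i] by auto
    qed
    then have "(\<Prod>i\<in>I. face_count 0 (G i)) = 2 ^ (\<Sum>i\<in>I. nat (aff_dim (G i)))"
      by (simp add: power_sum)
    also have "(\<Sum>i\<in>I. nat (aff_dim (G i))) = 2"
    proof -
      have "int (\<Sum>i\<in>I. nat (aff_dim (G i))) = (\<Sum>i\<in>I. aff_dim (G i))"
        using nonneg by simp
      then show ?thesis using dim(2) by linarith
    qed
    finally have "face_count 0 (\<Sum>i\<in>I. G i) = 4" using vert by simp
    moreover have "(\<Sum>i\<in>I. if aff_dim (G i) = 2 then 4 - int (face_count 0 (G i)) else 0) = 0"
      by (rule sum.neutral) (use False in auto)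
    ultimately show ?thesis by simp
  qed
qed

subsection \<open>Facet normals\<close>

lemma maximizer_face_set_plus:
  "maximizer_face (A + B) c = maximizer_face A c + maximizer_face B c"
proof (intro subset_antisym subsetI)
  fix x assume x: "x \<in> maximizer_face (A + B) c"
  then obtain a b where ab: "x = a + b" "a \<in> A" "b \<in> B"
    by (auto simp: maximizer_face_def elim: set_plus_elim)
  have le: "y \<bullet> c \<le> x \<bullet> c" if "y \<in> A + B" for y using x that by (auto simp: maximizer_face_def)
  have "a \<in> maximizer_face A c"
    using le[OF set_plus_intro[OF _ ab(3)]] ab by (auto simp: maximizer_face_def inner_add_left)
  moreover have "b \<in> maximizer_face B c"
    using le[OF set_plus_intro[OF ab(2)]] ab by (auto simp: maximizer_face_def inner_add_left)
  ultimately show "x \<in> maximizer_face A c + maximizer_face B c" using ab by auto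
next
  fix x assume "x \<in> maximizer_face A c + maximizer_face B c"
  then obtain a b where ab: "x = a + b" "a \<in> maximizer_face A c" "b \<in> maximizer_face B c"
    by (rule set_plus_elim)
  have "y \<bullet> c \<le> x \<bullet> c" if y: "y \<in> A + B" for y
  proof -
    obtain p q where "y = p + q" "p \<in> A" "q \<in> B" using y by (rule set_plus_elim)
    then show ?thesis using ab by (auto simp: maximizer_face_def inner_add_left intro!: add_mono)
  qed
  then show "x \<in> maximizer_face (A + B) c" using ab by (auto simp: maximizer_face_def)
qed

lemma maximizer_face_set_sum:
  assumes "finite I"
  shows "maximizer_face (\<Sum>i\<in>I. P i) c = (\<Sum>i\<in>I. maximizer_face (P i) c)"
  using assms
proof (induction I)
  case empty
  show ?case by (auto simp: maximizer_face_def set_zero)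
qed (simp add: maximizer_face_set_plus)

lemma maximizer_face_scaleR:
  assumes "r > 0"
  shows "maximizer_face P (r *\<^sub>R c) = maximizer_face P c"
  using assms by (simp add: maximizer_face_def)

lemma maximizer_face_0 [simp]: "maximizer_face P 0 = P"
  by (simp add: maximizer_face_def)

lemma maximizer_face_eq_hyperplane:
  assumes "x \<in> maximizer_face P c"
  shows "P \<subseteq> {y. c \<bullet> y \<le> c \<bullet> x}" "maximizer_face P c = P \<inter> {y. c \<bullet> y = c \<bullet> x}"
proof -
  have x: "x \<in> P" "\<And>y. y \<in> P \<Longrightarrow> c \<bullet> y \<le> c \<bullet> x"
    using assms by (auto simp: maximizer_face_def inner_commute)
  show "P \<subseteq> {y. c \<bullet> y \<le> c \<bullet> x}" using x(2) by blast
  show "maximizer_face P c = P \<inter> {y. c \<bullet> y = c \<bullet> x}"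
  proof (intro subset_antisym subsetI)
    fix y assume "y \<in> maximizer_face P c"
    then have "y \<in> P" "c \<bullet> x \<le> c \<bullet> y"
      using x(1) by (auto simp: maximizer_face_def inner_commute)
    then show "y \<in> P \<inter> {y. c \<bullet> y = c \<bullet> x}" using x(2) by (simp add: antisym)
  next
    fix y assume "y \<in> P \<inter> {y. c \<bullet> y = c \<bullet> x}"
    then show "y \<in> maximizer_face P c" using x(2) by (simp add: maximizer_face_def inner_commute)
  qed
qed

lemma maximizer_face_nonempty:
  assumes "polytope P" "P \<noteq> {}"
  shows "maximizer_face P c \<noteq> {}"
proof -
  have "continuous_on P (\<lambda>x. x \<bullet> c)" by (intro continuous_intros)
  then obtain x where "x \<in> P" "\<forall>y\<in>P. y \<bullet> c \<le> x \<bullet> c"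
    using continuous_attains_sup[OF polytope_imp_compact[OF assms(1)] assms(2)] by blast
  then show ?thesis by (auto simp: maximizer_face_def)
qed

lemma maximizer_face_face_of:
  assumes "convex P"
  shows "maximizer_face P c face_of P"
proof (cases "maximizer_face P c = {}")
  case False
  then obtain x where x: "x \<in> maximizer_face P c" by blast
  show ?thesis unfolding maximizer_face_eq_hyperplane(2)[OF x]
    by (rule face_of_Int_supporting_hyperplane_le[OF assms])
      (use maximizer_face_eq_hyperplane(1)[OF x] in auto)
qed simp

text \<open>For a full-dimensional polytope the unit length selects one vector per facet, giving an
  index that can be shared by several polytopes.\<close>

definition facet_normals :: "'a::euclidean_space set \<Rightarrow> 'a set" where
  "facet_normals P = {c. norm c = 1 \<and> aff_dim (maximizer_face P c) = int DIM('a) - 1}"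

text \<open>Both vectors describe the affine hull of the same facet as a hyperplane, so they are
  parallel; a point of \<open>P\<close> off this hyperplane fixes the sign of the factor.\<close>

lemma facet_normal_unique:
  fixes P :: "'a::euclidean_space set"
  assumes P: "aff_dim P = int DIM('a)" and c: "c \<noteq> 0" "c' \<noteq> 0"
    and eq: "maximizer_face P c = maximizer_face P c'"
    and dim: "aff_dim (maximizer_face P c) = int DIM('a) - 1"
  obtains r where "r > 0" "c' = r *\<^sub>R c"
proof -
  let ?F = "maximizer_face P c"
  have "0 < DIM('a)" by simp
  then have "?F \<noteq> {}" using dim by force
  then obtain x where x: "x \<in> ?F" by blast
  then have x': "x \<in> maximizer_face P c'" using eq by simp
  have hull: "affine hull ?F = {y. d \<bullet> y = d \<bullet> x}"
    if d: "d \<noteq> 0" "?F \<subseteq> {y. d \<bullet> y = d \<bullet> x}" for d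
  proof (rule affine_dim_equal)
    show "affine hull ?F \<subseteq> {y. d \<bullet> y = d \<bullet> x}"
      by (rule hull_minimal) (use d(2) affine_hyperplane in auto)
    show "aff_dim (affine hull ?F) = aff_dim {y. d \<bullet> y = d \<bullet> x}"
      using d(1) dim by simp
  qed (use x affine_hyperplane in auto)
  have h1: "affine hull ?F = {y. c \<bullet> y = c \<bullet> x}"
    by (rule hull) (use c maximizer_face_eq_hyperplane(2)[OF x] in auto)
  have h2: "affine hull ?F = {y. c' \<bullet> y = c' \<bullet> x}"
    by (rule hull) (use c maximizer_face_eq_hyperplane(2)[OF x'] eq in auto)
  \<comment> \<open>\<open>r *\<^sub>R c\<close> is the orthogonal projection of \<open>c'\<close>
    to the line of \<open>c\<close>. Moving along the remainder \<open>d\<close> stays in the common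
    hyperplane, so \<open>d\<close> is orthogonal to \<open>c'\<close> too and vanishes.\<close>
  define r where "r = (c' \<bullet> c) / (c \<bullet> c)"
  define d where "d = c' - r *\<^sub>R c"
  have cd: "c \<bullet> d = 0" using c by (simp add: d_def r_def inner_diff_right inner_commute)
  then have "x + d \<in> {y. c \<bullet> y = c \<bullet> x}" by (simp add: inner_add_right)
  then have "x + d \<in> {y. c' \<bullet> y = c' \<bullet> x}" using h1 h2 by simp
  then have "c' \<bullet> d = 0" by (simp add: inner_add_right)
  then have "d \<bullet> d = 0" using cd by (simp add: d_def inner_diff_left)
  then have c': "c' = r *\<^sub>R c" by (simp add: d_def)
  have "\<not> P \<subseteq> {y. c \<bullet> y = c \<bullet> x}"
    using aff_dim_subset[of P "{y. c \<bullet> y = c \<bullet> x}"] P c by auto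
  then obtain y where y: "y \<in> P" "c \<bullet> y \<noteq> c \<bullet> x" by blast
  then have lt: "c \<bullet> y < c \<bullet> x" using maximizer_face_eq_hyperplane(1)[OF x] by force
  have "c' \<bullet> y \<le> c' \<bullet> x" using maximizer_face_eq_hyperplane(1)[OF x'] y by blast
  then have "r * (c \<bullet> y) \<le> r * (c \<bullet> x)" by (simp add: c')
  then have "r \<ge> 0" using lt by (metis linorder_not_le mult_le_cancel_left)
  moreover have "r \<noteq> 0" using c c' by auto
  ultimately show ?thesis by (intro that[of r] c') simp
qed

lemma bij_betw_facet_normals:
  fixes P :: "'a::euclidean_space set"
  assumes P: "polytope P" "aff_dim P = int DIM('a)"
  shows "bij_betw (maximizer_face P) (facet_normals P)
    {F. F face_of P \<and> aff_dim F = int DIM('a) - 1}"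
proof (rule bij_betwI')
  fix c c' assume c: "c \<in> facet_normals P" and c': "c' \<in> facet_normals P"
  show "(maximizer_face P c = maximizer_face P c') = (c = c')"
  proof
    assume eq: "maximizer_face P c = maximizer_face P c'"
    have "c \<noteq> 0" "c' \<noteq> 0" "aff_dim (maximizer_face P c) = int DIM('a) - 1"
      using c c' by (auto simp: facet_normals_def)
    then obtain r where "r > 0" "c' = r *\<^sub>R c"
      using facet_normal_unique[OF P(2) _ _ eq] by blast
    then show "c = c'" using c c' by (simp add: facet_normals_def)
  qed auto
next
  fix c assume "c \<in> facet_normals P"
  then show "maximizer_face P c \<in> {F. F face_of P \<and> aff_dim F = int DIM('a) - 1}"
    using maximizer_face_face_of polytope_imp_convex[OF P(1)] by (auto simp: facet_normals_def)
next
  fix F assume F: "F \<in> {F. F face_of P \<and> aff_dim F = int DIM('a) - 1}"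
  have "0 < DIM('a)" by simp
  then have "F \<noteq> {}" using F by force
  then have "F facet_of P" using F P by (simp add: facet_of_def)
  then obtain a b where ab: "a \<noteq> 0" "P \<subseteq> {x. a \<bullet> x \<le> b}" "F = P \<inter> {x. a \<bullet> x = b}"
    using facet_supporting_hyperplane[OF polytope_imp_polyhedron[OF P(1)]] by metis
  have "maximizer_face P a = F"
    using ab(2,3) \<open>F \<noteq> {}\<close> by (force simp: maximizer_face_def inner_commute)
  then have *: "maximizer_face P (inverse (norm a) *\<^sub>R a) = F"
    using ab(1) by (simp add: maximizer_face_scaleR)
  moreover have "norm (inverse (norm a) *\<^sub>R a) = 1" using ab(1) by simp
  ultimately show "\<exists>c\<in>facet_normals P. F = maximizer_face P c"
    using F by (force simp: facet_normals_def)
qed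

lemma finite_facet_normals:
  fixes P :: "'a::euclidean_space set"
  assumes "polytope P" "aff_dim P = int DIM('a)"
  shows "finite (facet_normals P)"
proof -
  have "finite {F. F face_of P \<and> aff_dim F = int DIM('a) - 1}"
    by (rule finite_subset[OF _ finite_polytope_faces[OF assms(1)]]) auto
  then show ?thesis using bij_betw_finite[OF bij_betw_facet_normals[OF assms]] by simp
qed

text \<open>The exact decomposition is given by some vector \<open>c'\<close> that selects the same
  facet as \<open>c\<close>. It is a positive multiple of \<open>c\<close>, so it selects the same
  faces of the summands.\<close>

lemma general_position_exact:
  fixes P :: "nat \<Rightarrow> 'a::euclidean_space set"
  assumes gp: "relatively_in_general_position n P"
    and Q: "polytope (\<Sum>i = 1..n. P i)" "aff_dim (\<Sum>i = 1..n. P i) = int DIM('a)"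
    and c: "c \<in> facet_normals (\<Sum>i = 1..n. P i)"
  shows "(\<Sum>i = 1..n. aff_dim (maximizer_face (P i) c)) = int DIM('a) - 1"
proof -
  let ?Q = "\<Sum>i = 1..n. P i"
  have dim: "aff_dim (maximizer_face ?Q c) = int DIM('a) - 1"
    using c by (simp add: facet_normals_def)
  have "0 < DIM('a)" by simp
  then have "maximizer_face ?Q c \<noteq> {}" using dim by force
  then have "maximizer_face ?Q c facet_of ?Q"
    using maximizer_face_face_of[OF polytope_imp_convex[OF Q(1)]] dim Q(2)
    by (simp add: facet_of_def)
  then obtain G where G: "exact_decomposition n P (maximizer_face ?Q c) G"
    using gp by (auto simp: relatively_in_general_position_def)
  then obtain c' where c': "\<And>i. i \<in> {1..n} \<Longrightarrow> G i = maximizer_face (P i) c'"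
    by (auto simp: exact_decomposition_def minkowski_decomposition_def)
  have FG: "maximizer_face ?Q c = (\<Sum>i = 1..n. G i)"
    and dG: "aff_dim (maximizer_face ?Q c) = (\<Sum>i = 1..n. aff_dim (G i))"
    using G by (auto simp: exact_decomposition_def minkowski_decomposition_def)
  have "(\<Sum>i = 1..n. G i) = (\<Sum>i = 1..n. maximizer_face (P i) c')"
    by (rule sum.cong) (use c' in auto)
  then have eq: "maximizer_face ?Q c = maximizer_face ?Q c'"
    using FG maximizer_face_set_sum[of "{1..n}" P c'] by simp
  \<comment> \<open>The zero vector would select the whole sum, whose dimension exceeds that of a
    facet.\<close>
  have "c' \<noteq> 0" using eq dim Q(2) by auto
  moreover have "c \<noteq> 0" using c by (auto simp: facet_normals_def)
  ultimately obtain r where r: "r > 0" "c' = r *\<^sub>R c"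
    using facet_normal_unique[OF Q(2) _ _ eq dim] by blast
  have "(\<Sum>i = 1..n. aff_dim (G i)) = (\<Sum>i = 1..n. aff_dim (maximizer_face (P i) c))"
  proof (rule sum.cong[OF refl])
    fix i assume "i \<in> {1..n}"
    then show "aff_dim (G i) = aff_dim (maximizer_face (P i) c)"
      using c'[of i] by (simp only: r(2) maximizer_face_scaleR[OF r(1)])
  qed
  then show ?thesis using dG dim by simp
qed

lemma sum_facet_normals_vertices:
  fixes P :: "(real ^ 3) set"
  assumes P: "polytope P" "aff_dim P = 3"
  shows "(\<Sum>c\<in>facet_normals P. 4 - int (face_count 0 (maximizer_face P c)))
    = 4 * int (face_count 2 P) - 2 * int (face_count 1 P)"
  using sum.reindex_bij_betw[OF bij_betw_facet_normals[OF P(1)],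
      of "\<lambda>F. 4 - int (face_count 0 F)"] sum_facet_vertices[OF P] P by simp

theorem theorem3:
  fixes n :: nat and P :: "nat \<Rightarrow> (real ^ 3) set" and Q :: "(real ^ 3) set"
  assumes "n \<ge> 1"
    and "\<And>i. i \<in> {1..n} \<Longrightarrow> polytope (P i)"
    and "\<And>i. i \<in> {1..n} \<Longrightarrow> aff_dim (P i) = 3"
    and "relatively_in_general_position n P"
    and "Q = (\<Sum>i = 1..n. P i)"
  shows "2 * int (face_count 2 Q) - int (face_count 1 Q)
           = (\<Sum>i = 1..n. 2 * int (face_count 2 (P i)) - int (face_count 1 (P i)))
       \<and> int (face_count 2 Q) - int (face_count 0 Q) + 2
           = (\<Sum>i = 1..n. int (face_count 2 (P i)) - int (face_count 0 (P i)) + 2)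
       \<and> int (face_count 1 Q) - 2 * int (face_count 0 Q) + 4
           = (\<Sum>i = 1..n. int (face_count 1 (P i)) - 2 * int (face_count 0 (P i)) + 4)"
proof -
  let ?I = "{1..n}"
  let ?w = "\<lambda>F :: (real ^ 3) set. 4 - int (face_count 0 F)"
  note Q = \<open>Q = (\<Sum>i = 1..n. P i)\<close>
  have P: "polytope (P i)" "aff_dim (P i) = 3" "P i \<noteq> {}" if "i \<in> ?I" for i
    using assms(2,3)[OF that] by auto
  have Qpoly: "polytope Q" unfolding Q by (rule polytope_set_sum) (use P in auto)
  have "aff_dim (P 1) \<le> aff_dim Q" unfolding Q
    by (rule aff_dim_le_set_sum) (use P assms(1) in auto)
  then have Qdim: "aff_dim Q = 3"
    using P(2)[of 1] assms(1) aff_dim_le_DIM[of Q] by simp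
  have Qmax: "maximizer_face Q c = (\<Sum>i = 1..n. maximizer_face (P i) c)" for c
    unfolding Q by (rule maximizer_face_set_sum) simp
  have ne: "maximizer_face (P i) c \<noteq> {}" if "i \<in> ?I" for i c
    using maximizer_face_nonempty P that by blast
  have poly: "polytope (maximizer_face (P i) c)" if "i \<in> ?I" for i c
    using face_of_polytope_polytope maximizer_face_face_of polytope_imp_convex P(1)[OF that] by blast
  have local: "?w (maximizer_face Q c)
      = (\<Sum>i\<in>?I. if aff_dim (maximizer_face (P i) c) = 2 then ?w (maximizer_face (P i) c) else 0)"
    if c: "c \<in> facet_normals Q" for c
    unfolding Qmax
  proof (rule exact_polygon_sum_vertices)
    show "aff_dim (\<Sum>i = 1..n. maximizer_face (P i) c) = 2"
      using c Qmax by (simp add: facet_normals_def)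
    show "(\<Sum>i = 1..n. aff_dim (maximizer_face (P i) c)) = 2"
      using general_position_exact[OF assms(4), of c] c Qpoly Qdim Q by simp
  qed (use ne poly in auto)
  \<comment> \<open>A polygon selected in \<open>P i\<close> makes the face selected in
    \<open>Q\<close> at least two-dimensional, and that face is proper because \<open>Q\<close> lies
    in no hyperplane. So every facet normal of \<open>P i\<close> is one of
    \<open>Q\<close>.\<close>
  have normals: "{c \<in> facet_normals Q. aff_dim (maximizer_face (P i) c) = 2} = facet_normals (P i)"
    if i: "i \<in> ?I" for i
  proof -
    have "c \<in> facet_normals Q" if c: "c \<in> facet_normals (P i)" for c
    proof -
      have c': "norm c = 1" "aff_dim (maximizer_face (P i) c) = 2"
        using c by (auto simp: facet_normals_def)
      have "2 \<le> aff_dim (maximizer_face Q c)"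
        unfolding Qmax c'(2)[symmetric] by (rule aff_dim_le_set_sum) (use i ne in auto)
      moreover have "maximizer_face Q c \<noteq> Q"
      proof
        assume eq: "maximizer_face Q c = Q"
        obtain x where "x \<in> Q" using Qdim by force
        then have "Q \<subseteq> {y. c \<bullet> y = c \<bullet> x}"
          using maximizer_face_eq_hyperplane(2)[of x Q c] eq by auto
        moreover have "c \<noteq> 0" using c'(1) by auto
        ultimately show False
          using aff_dim_subset[of Q "{y. c \<bullet> y = c \<bullet> x}"] Qdim by simp
      qed
      ultimately show ?thesis
        using face_of_aff_dim_lt[OF polytope_imp_convex[OF Qpoly]
            maximizer_face_face_of[OF polytope_imp_convex[OF Qpoly]]] Qdim c'(1)
        by (force simp: facet_normals_def)
    qed
    then show ?thesis by (auto simp: facet_normals_def)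
  qed
  have fin: "finite (facet_normals Q)" using finite_facet_normals[OF Qpoly] Qdim by simp
  have "(\<Sum>c\<in>facet_normals Q. ?w (maximizer_face Q c)) = (\<Sum>c\<in>facet_normals Q. \<Sum>i\<in>?I.
      if aff_dim (maximizer_face (P i) c) = 2 then ?w (maximizer_face (P i) c) else 0)"
    by (rule sum.cong[OF refl local])
  also have "\<dots> = (\<Sum>i\<in>?I. \<Sum>c\<in>facet_normals Q.
      if aff_dim (maximizer_face (P i) c) = 2 then ?w (maximizer_face (P i) c) else 0)"
    by (rule sum.swap)
  also have "\<dots> = (\<Sum>i\<in>?I. \<Sum>c\<in>facet_normals (P i). ?w (maximizer_face (P i) c))"
    by (rule sum.cong[OF refl]) (simp add: sum.inter_filter[OF fin, symmetric] normals)
  also have "\<dots> = (\<Sum>i\<in>?I. 4 * int (face_count 2 (P i)) - 2 * int (face_count 1 (P i)))"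
    by (rule sum.cong[OF refl]) (rule sum_facet_normals_vertices; use P in blast)
  finally have "4 * int (face_count 2 Q) - 2 * int (face_count 1 Q)
      = 2 * (\<Sum>i\<in>?I. 2 * int (face_count 2 (P i)) - int (face_count 1 (P i)))"
    using sum_facet_normals_vertices[OF Qpoly Qdim]
    by (simp add: sum_distrib_left right_diff_distrib)
  then have first: "2 * int (face_count 2 Q) - int (face_count 1 Q)
      = (\<Sum>i\<in>?I. 2 * int (face_count 2 (P i)) - int (face_count 1 (P i)))"
    by linarith
  have euler: "int (face_count 0 R) = 2 + int (face_count 1 R) - int (face_count 2 R)"
    if "polytope R" "aff_dim R = 3" for R :: "(real ^ 3) set"
    using euler_polyhedron_formula[OF that] by linarith
  \<comment> \<open>For each single polytope the Euler relation turns the second and third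
    expressions, with their constants 2 and 4, into the first; additivity then carries over term by
    term.\<close>
  have second: "int (face_count 2 R) - int (face_count 0 R) + 2
      = 2 * int (face_count 2 R) - int (face_count 1 R)"
    and third: "int (face_count 1 R) - 2 * int (face_count 0 R) + 4
      = 2 * int (face_count 2 R) - int (face_count 1 R)"
    if "polytope R" "aff_dim R = 3" for R :: "(real ^ 3) set"
    using euler[OF that] by linarith+
  have "(\<Sum>i\<in>?I. int (face_count 2 (P i)) - int (face_count 0 (P i)) + 2)
      = (\<Sum>i\<in>?I. 2 * int (face_count 2 (P i)) - int (face_count 1 (P i)))"
    by (rule sum.cong[OF refl]) (rule second; use P in blast)
  moreover have "(\<Sum>i\<in>?I. int (face_count 1 (P i)) - 2 * int (face_count 0 (P i)) + 4)
      = (\<Sum>i\<in>?I. 2 * int (face_count 2 (P i)) - int (face_count 1 (P i)))"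
    by (rule sum.cong[OF refl]) (rule third; use P in blast)
  ultimately show ?thesis using first second[OF Qpoly Qdim] third[OF Qpoly Qdim] by simp
qed

end
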